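(* Let $(\mathsf{Cofib},\mathsf{Fib},\mathsf{Weq})$ be a model structure on a weakly idempotent complete additive category $\mathcal A$, with classes $\mathcal C$, $\mathcal F$, $\mathcal W$ of cofibrant, fibrant and trivial objects respectively. Let $f,g:A\to B$ be morphisms with $A,B\in\mathcal C\cap\mathcal F$. Then $f\sim g$ if and only if $f-g$ factors through an object in $\mathcal C\cap\mathcal F\cap\mathcal W$.
   Context: An additive category is weakly idempotent complete if every split epimorphism has a kernel (equivalently, every split monomorphism has a cokernel). A model structure (Quillen) on a category $\mathcal A$ is a triple $(\mathsf{Cofib},\mathsf{Fib},\mathsf{Weq})$ of classes of morphisms satisfying the two-out-of-three axiom (for $\mathsf{Weq}$), the retract axiom (all three classes are closed under retracts), the lifting axiom (cofibrations lift against trivial fibrations, trivial cofibrations lift against fibrations) and the factorization axiom (every morphism factors as a cofibration followed by a trivial fibration and as a trivial cofibration followed by a fibration), where trivial (co)fibrations are the (co)fibrations lying in $\mathsf{Weq}$; no existence of limits or colimits beyond those of $\mathcal A$ is assumed. $X$ is cofibrant if $0\to X$ is in $\mathsf{Cofib}$, fibrant if $X\to0$ is in $\mathsf{Fib}$, trivial if $0\to X$ is in $\mathsf{Weq}$ (equivalently $X\to 0$ is). Two morphisms $f,g:A\to B$ are left homotopic, $f\overset{l}{\sim}g$, if there are an object $\widetilde A$, a weak equivalence $\sigma:\widetilde A\to A$, morphisms $\partial_0,\partial_1:A\to\widetilde A$ with $\sigma\partial_0=\sigma\partial_1=\mathrm{Id}_A$, and $h:\widetilde A\to B$ with $h\partial_0=f$,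 $h\partial_1=g$. Right homotopy $\overset{r}{\sim}$ is defined dually. On $\mathcal C\cap\mathcal F$ (the full subcategory of cofibrant-fibrant objects) the two relations coincide and form an equivalence relation, denoted $\sim$. *)

theory Defs
  imports "HOL-Algebra.Group"
begin

section \<open>Categories\<close>

record ('o, 'm) category_data =
  Obj :: "'o set"
  Arr :: "'m set"
  Dom :: "'m \<Rightarrow> 'o"
  Cod :: "'m \<Rightarrow> 'o"
  Id :: "'o \<Rightarrow> 'm"
  Comp :: "'m \<Rightarrow> 'm \<Rightarrow> 'm"  (infixr "\<cdot>\<index>" 70)

definition Hom :: "('o, 'm, 'x) category_data_scheme \<Rightarrow> 'o \<Rightarrow> 'o \<Rightarrow> 'm set"
  where "Hom C a b = {f \<in> Arr C. Dom C f = a \<and> Cod C f = b}"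

text \<open>Composition is in the usual order: \<open>g \<cdot> f\<close> is \<open>f\<close> followed by \<open>g\<close>.\<close>

locale category =
  fixes C :: "('o, 'm, 'x) category_data_scheme" (structure)
  assumes Dom_in_Obj: "f \<in> Arr C \<Longrightarrow> Dom C f \<in> Obj C"
    and Cod_in_Obj: "f \<in> Arr C \<Longrightarrow> Cod C f \<in> Obj C"
    and Id_in_Hom: "a \<in> Obj C \<Longrightarrow> Id C a \<in> Hom C a a"
    and Comp_in_Hom: "f \<in> Hom C a b \<Longrightarrow> g \<in> Hom C b c \<Longrightarrow> g \<cdot> f \<in> Hom C a c"
    and Comp_Id: "f \<in> Hom C a b \<Longrightarrow> f \<cdot> Id C a = f"
    and Id_Comp: "f \<in> Hom C a b \<Longrightarrow> Id C b \<cdot> f = f"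
    and Comp_assoc: "f \<in> Hom C a b \<Longrightarrow> g \<in> Hom C b c \<Longrightarrow> h \<in> Hom C c d \<Longrightarrow>
      (h \<cdot> g) \<cdot> f = h \<cdot> (g \<cdot> f)"


section \<open>Weakly idempotent complete additive categories\<close>

text \<open>
  The abelian groups \<open>Hom_group a b\<close> are written multiplicatively, following the library:
  their operation \<open>\<otimes>\<close> is the addition of morphisms and their unit is the zero morphism.
  A zero object is part of the data, so that \<open>0 \<rightarrow> X\<close> and \<open>X \<rightarrow> 0\<close> have a definite meaning.
\<close>

record ('o, 'm) additive_data = "('o, 'm) category_data" +
  Hom_group :: "'o \<Rightarrow> 'o \<Rightarrow> 'm monoid"
  Zero_obj :: 'o

definition plus_arr :: "('o, 'm, 'x) additive_data_scheme \<Rightarrow> 'm \<Rightarrow> 'm \<Rightarrow> 'm"  (infixl "\<^bold>+\<index>" 65)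
  where "plus_arr C f g = f \<otimes>\<^bsub>Hom_group C (Dom C f) (Cod C f)\<^esub> g"

definition minus_arr :: "('o, 'm, 'x) additive_data_scheme \<Rightarrow> 'm \<Rightarrow> 'm \<Rightarrow> 'm"  (infixl "\<^bold>-\<index>" 65)
  where "minus_arr C f g =
    f \<otimes>\<^bsub>Hom_group C (Dom C f) (Cod C f)\<^esub> inv\<^bsub>Hom_group C (Dom C f) (Cod C f)\<^esub> g"

definition zero_arr :: "('o, 'm, 'x) additive_data_scheme \<Rightarrow> 'o \<Rightarrow> 'o \<Rightarrow> 'm"
  where "zero_arr C a b = \<one>\<^bsub>Hom_group C a b\<^esub>"

definition is_zero_object :: "('o, 'm, 'x) category_data_scheme \<Rightarrow> 'o \<Rightarrow> bool"
  where "is_zero_object C z \<longleftrightarrow> z \<in> Obj C \<and>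
    (\<forall>a \<in> Obj C. (\<exists>!f. f \<in> Hom C z a) \<and> (\<exists>!f. f \<in> Hom C a z))"

definition is_biproduct ::
  "('o, 'm, 'x) additive_data_scheme \<Rightarrow> 'o \<Rightarrow> 'o \<Rightarrow> 'o \<Rightarrow> 'm \<Rightarrow> 'm \<Rightarrow> 'm \<Rightarrow> 'm \<Rightarrow> bool"
  where "is_biproduct C a b s i j p q \<longleftrightarrow>
    s \<in> Obj C \<and> i \<in> Hom C a s \<and> j \<in> Hom C b s \<and> p \<in> Hom C s a \<and> q \<in> Hom C s b \<and>
    p \<cdot> i = Id C a \<and> q \<cdot> j = Id C b \<and> p \<cdot> j = zero_arr C b a \<and> q \<cdot> i = zero_arr C a b \<and>
    (i \<cdot> p) \<^bold>+ (j \<cdot> q) = Id C s"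
  for C (structure)

locale additive_category = category C
  for C :: "('o, 'm, 'x) additive_data_scheme" (structure) +
  assumes carrier_Hom_group:
      "a \<in> Obj C \<Longrightarrow> b \<in> Obj C \<Longrightarrow> carrier (Hom_group C a b) = Hom C a b"
    and comm_group_Hom_group:
      "a \<in> Obj C \<Longrightarrow> b \<in> Obj C \<Longrightarrow> comm_group (Hom_group C a b)"
    and Comp_plus_left:
      "f \<in> Hom C a b \<Longrightarrow> g \<in> Hom C b c \<Longrightarrow> g' \<in> Hom C b c \<Longrightarrow>
        (g \<^bold>+ g') \<cdot> f = (g \<cdot> f) \<^bold>+ (g' \<cdot> f)"
    and Comp_plus_right:
      "f \<in> Hom C a b \<Longrightarrow> f' \<in> Hom C a b \<Longrightarrow> g \<in> Hom C b c \<Longrightarrow>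
        g \<cdot> (f \<^bold>+ f') = (g \<cdot> f) \<^bold>+ (g \<cdot> f')"
    and Zero_obj_is_zero: "is_zero_object C (Zero_obj C)"
    and biproducts:
      "a \<in> Obj C \<Longrightarrow> b \<in> Obj C \<Longrightarrow> \<exists>s i j p q. is_biproduct C a b s i j p q"

definition split_epi :: "('o, 'm, 'x) category_data_scheme \<Rightarrow> 'm \<Rightarrow> bool"
  where "split_epi C p \<longleftrightarrow> p \<in> Arr C \<and>
    (\<exists>s \<in> Hom C (Cod C p) (Dom C p). p \<cdot> s = Id C (Cod C p))"
  for C (structure)

definition is_kernel :: "('o, 'm, 'x) additive_data_scheme \<Rightarrow> 'm \<Rightarrow> 'm \<Rightarrow> bool"
  where "is_kernel C p k \<longleftrightarrow> p \<in> Arr C \<and> k \<in> Arr C \<and> Cod C k = Dom C p \<and>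
    p \<cdot> k = zero_arr C (Dom C k) (Cod C p) \<and>
    (\<forall>t \<in> Obj C. \<forall>u \<in> Hom C t (Dom C p). p \<cdot> u = zero_arr C t (Cod C p) \<longrightarrow>
      (\<exists>!v. v \<in> Hom C t (Dom C k) \<and> k \<cdot> v = u))"
  for C (structure)

locale wic_additive_category = additive_category C
  for C :: "('o, 'm, 'x) additive_data_scheme" (structure) +
  assumes weakly_idempotent_complete: "split_epi C p \<Longrightarrow> \<exists>k. is_kernel C p k"


section \<open>Model structures\<close>

definition retract_of :: "('o, 'm, 'x) category_data_scheme \<Rightarrow> 'm \<Rightarrow> 'm \<Rightarrow> bool"
  where "retract_of C f g \<longleftrightarrow> f \<in> Arr C \<and> g \<in> Arr C \<and>
    (\<exists>i \<in> Hom C (Dom C f) (Dom C g). \<exists>r \<in> Hom C (Dom C g) (Dom C f).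
     \<exists>i' \<in> Hom C (Cod C f) (Cod C g). \<exists>r' \<in> Hom C (Cod C g) (Cod C f).
       r \<cdot> i = Id C (Dom C f) \<and> r' \<cdot> i' = Id C (Cod C f) \<and>
       g \<cdot> i = i' \<cdot> f \<and> f \<cdot> r = r' \<cdot> g)"
  for C (structure)

definition lifts_against :: "('o, 'm, 'x) category_data_scheme \<Rightarrow> 'm \<Rightarrow> 'm \<Rightarrow> bool"
  where "lifts_against C i p \<longleftrightarrow>
    (\<forall>u \<in> Hom C (Dom C i) (Dom C p). \<forall>v \<in> Hom C (Cod C i) (Cod C p).
      p \<cdot> u = v \<cdot> i \<longrightarrow>
      (\<exists>l \<in> Hom C (Cod C i) (Dom C p). l \<cdot> i = u \<and> p \<cdot> l = v))"
  for C (structure)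

definition factors_as :: "('o, 'm, 'x) category_data_scheme \<Rightarrow> 'm \<Rightarrow> 'm set \<Rightarrow> 'm set \<Rightarrow> bool"
  where "factors_as C f L R \<longleftrightarrow>
    (\<exists>i \<in> L. \<exists>p \<in> R. i \<in> Arr C \<and> p \<in> Arr C \<and> Cod C i = Dom C p \<and> f = p \<cdot> i)"
  for C (structure)

locale model_structure = category C
  for C :: "('o, 'm, 'x) category_data_scheme" (structure)
    and Cofib Fib Weq :: "'m set" +
  assumes Cofib_subset: "Cofib \<subseteq> Arr C"
    and Fib_subset: "Fib \<subseteq> Arr C"
    and Weq_subset: "Weq \<subseteq> Arr C"
    and two_of_three_comp:
      "f \<in> Hom C a b \<Longrightarrow> g \<in> Hom C b c \<Longrightarrow> f \<in> Weq \<Longrightarrow> g \<in> Weq \<Longrightarrow> g \<cdot> f \<in> Weq"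
    and two_of_three_left:
      "f \<in> Hom C a b \<Longrightarrow> g \<in> Hom C b c \<Longrightarrow> f \<in> Weq \<Longrightarrow> g \<cdot> f \<in> Weq \<Longrightarrow> g \<in> Weq"
    and two_of_three_right:
      "f \<in> Hom C a b \<Longrightarrow> g \<in> Hom C b c \<Longrightarrow> g \<in> Weq \<Longrightarrow> g \<cdot> f \<in> Weq \<Longrightarrow> f \<in> Weq"
    and Cofib_retract: "retract_of C f g \<Longrightarrow> g \<in> Cofib \<Longrightarrow> f \<in> Cofib"
    and Fib_retract: "retract_of C f g \<Longrightarrow> g \<in> Fib \<Longrightarrow> f \<in> Fib"
    and Weq_retract: "retract_of C f g \<Longrightarrow> g \<in> Weq \<Longrightarrow> f \<in> Weq"
    and Cofib_lifts: "i \<in> Cofib \<Longrightarrow> p \<in> Fib \<inter> Weq \<Longrightarrow> lifts_against C i p"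
    and TCofib_lifts: "i \<in> Cofib \<inter> Weq \<Longrightarrow> p \<in> Fib \<Longrightarrow> lifts_against C i p"
    and Cofib_TFib_factor: "f \<in> Arr C \<Longrightarrow> factors_as C f Cofib (Fib \<inter> Weq)"
    and TCofib_Fib_factor: "f \<in> Arr C \<Longrightarrow> factors_as C f (Cofib \<inter> Weq) Fib"

definition cofibrant_objects :: "('o, 'm, 'x) additive_data_scheme \<Rightarrow> 'm set \<Rightarrow> 'o set"
  where "cofibrant_objects C Cofib = {X \<in> Obj C. zero_arr C (Zero_obj C) X \<in> Cofib}"

definition fibrant_objects :: "('o, 'm, 'x) additive_data_scheme \<Rightarrow> 'm set \<Rightarrow> 'o set"
  where "fibrant_objects C Fib = {X \<in> Obj C. zero_arr C X (Zero_obj C) \<in> Fib}"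

definition trivial_objects :: "('o, 'm, 'x) additive_data_scheme \<Rightarrow> 'm set \<Rightarrow> 'o set"
  where "trivial_objects C Weq = {X \<in> Obj C. zero_arr C (Zero_obj C) X \<in> Weq}"


section \<open>Homotopy\<close>

definition left_homotopic ::
  "('o, 'm, 'x) category_data_scheme \<Rightarrow> 'm set \<Rightarrow> 'o \<Rightarrow> 'o \<Rightarrow> 'm \<Rightarrow> 'm \<Rightarrow> bool"
  where "left_homotopic C Weq A B f g \<longleftrightarrow> f \<in> Hom C A B \<and> g \<in> Hom C A B \<and>
    (\<exists>A' \<in> Obj C. \<exists>\<sigma> \<in> Hom C A' A \<inter> Weq. \<exists>d0 \<in> Hom C A A'. \<exists>d1 \<in> Hom C A A'. \<exists>h \<in> Hom C A' B.
       \<sigma> \<cdot> d0 = Id C A \<and> \<sigma> \<cdot> d1 = Id C A \<and> h \<cdot> d0 = f \<and> h \<cdot> d1 = g)"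
  for C (structure)

definition right_homotopic ::
  "('o, 'm, 'x) category_data_scheme \<Rightarrow> 'm set \<Rightarrow> 'o \<Rightarrow> 'o \<Rightarrow> 'm \<Rightarrow> 'm \<Rightarrow> bool"
  where "right_homotopic C Weq A B f g \<longleftrightarrow> f \<in> Hom C A B \<and> g \<in> Hom C A B \<and>
    (\<exists>B' \<in> Obj C. \<exists>\<sigma> \<in> Hom C B B' \<inter> Weq. \<exists>d0 \<in> Hom C B' B. \<exists>d1 \<in> Hom C B' B. \<exists>h \<in> Hom C A B'.
       d0 \<cdot> \<sigma> = Id C B \<and> d1 \<cdot> \<sigma> = Id C B \<and> d0 \<cdot> h = f \<and> d1 \<cdot> h = g)"
  for C (structure)

definition factors_through ::
  "('o, 'm, 'x) category_data_scheme \<Rightarrow> 'm \<Rightarrow> 'o \<Rightarrow> bool"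
  where "factors_through C f W \<longleftrightarrow>
    (\<exists>u \<in> Hom C (Dom C f) W. \<exists>v \<in> Hom C W (Cod C f). f = v \<cdot> u)"
  for C (structure)

end

theory Submission
  imports Defs
begin

text \<open>
  By weak idempotent completeness, a left homotopy with cylinder \<open>\<sigma> : E \<rightarrow> A\<close> splits as
  \<open>E = A \<oplus> K\<close>; here \<open>0 \<rightarrow> K\<close> is a retract of the weak equivalence \<open>A \<rightarrow> E\<close>, so \<open>K\<close> is trivial,
  and the difference of the two sections of \<open>\<sigma>\<close> factors through \<open>K\<close>. Since \<open>A\<close> is cofibrant and
  \<open>B\<close> is fibrant, \<open>K\<close> may be replaced by a cofibrant, fibrant and trivial object. Conversely, if
  \<open>f - g\<close> factors through such an object \<open>W\<close>, then \<open>A \<rightarrow> A \<oplus> W\<close> is a pushout of the trivial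
  cofibration \<open>0 \<rightarrow> W\<close>, and \<open>A \<oplus> W\<close> is a cylinder for a homotopy from \<open>f\<close> to \<open>g\<close>. Right homotopies
  are treated with \<open>B \<oplus> K\<close> and \<open>B \<oplus> W\<close> as path objects.
\<close>

section \<open>Additive categories\<close>

context category
begin

lemma in_HomI: "f \<in> Arr C \<Longrightarrow> f \<in> Hom C (Dom C f) (Cod C f)"
  by (simp add: Hom_def)

lemma Hom_Dom: "f \<in> Hom C a b \<Longrightarrow> Dom C f = a"
  by (simp add: Hom_def)

lemma Hom_Cod: "f \<in> Hom C a b \<Longrightarrow> Cod C f = b"
  by (simp add: Hom_def)

lemma Hom_Arr: "f \<in> Hom C a b \<Longrightarrow> f \<in> Arr C"
  by (simp add: Hom_def)

lemma Hom_Obj: "f \<in> Hom C a b \<Longrightarrow> a \<in> Obj C \<and> b \<in> Obj C"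
  using Dom_in_Obj Cod_in_Obj by (auto simp: Hom_def)

text \<open>The retract argument. A diagonal of the square
  \<open>p \<cdot> i = Id C b \<cdot> f\<close> is a section of \<open>p\<close> that carries
  \<open>f\<close> to \<open>i\<close>, so it exhibits \<open>f\<close> as a retract of
  \<open>i\<close> with identities on the common domain. To place \<open>f\<close> in a class closed
  under retracts, it thus suffices to lift against the right factor of one suitable
  factorization.\<close>

lemma retract_of_left_factor:
  assumes i: "i \<in> Hom C a e" and p: "p \<in> Hom C e b" and f: "f = p \<cdot> i"
    and lift: "lifts_against C f p"
  shows "retract_of C f i"
proof -
  have fH: "f \<in> Hom C a b"
    using i p f Comp_in_Hom by simp
  have ob: "a \<in> Obj C" "b \<in> Obj C"
    using Hom_Obj[OF fH] by auto
  have "p \<cdot> i = Id C b \<cdot> f"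
    using f Id_Comp[OF fH] by simp
  then obtain l where l: "l \<in> Hom C b e" "l \<cdot> f = i" "p \<cdot> l = Id C b"
    using lift i Id_in_Hom[OF ob(2)]
    unfolding lifts_against_def Hom_Dom[OF fH] Hom_Cod[OF fH] Hom_Dom[OF p] Hom_Cod[OF p]
    by blast
  show ?thesis
    unfolding retract_of_def Hom_Dom[OF fH] Hom_Cod[OF fH] Hom_Dom[OF i] Hom_Cod[OF i]
  proof (intro conjI bexI)
    show "Id C a \<cdot> Id C a = Id C a"
      using Id_Comp Id_in_Hom ob(1) by blast
    show "i \<cdot> Id C a = l \<cdot> f" "f \<cdot> Id C a = p \<cdot> i"
      using Comp_Id[OF i] Comp_Id[OF fH] l(2) f by auto
  qed (use l p ob Id_in_Hom Hom_Arr[OF fH] Hom_Arr[OF i] in auto)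
qed

end

section \<open>Arithmetic of morphisms\<close>

context additive_category
begin

lemma zero_in_Hom: "a \<in> Obj C \<Longrightarrow> b \<in> Obj C \<Longrightarrow> zero_arr C a b \<in> Hom C a b"
  using comm_group.axioms(2) comm_group_Hom_group carrier_Hom_group group.is_monoid monoid.one_closed
  unfolding zero_arr_def by metis

lemma plus_in_Hom:
  assumes "f \<in> Hom C a b" "g \<in> Hom C a b"
  shows "f \<^bold>+ g \<in> Hom C a b"
proof -
  interpret G: comm_group "Hom_group C a b"
    using comm_group_Hom_group Hom_Obj[OF assms(1)] by blast
  show ?thesis
    using assms carrier_Hom_group Hom_Obj[OF assms(1)] G.m_closed
    by (auto simp: plus_arr_def Hom_Dom[OF assms(1)] Hom_Cod[OF assms(1)])
qed

lemma minus_in_Hom: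
  assumes "f \<in> Hom C a b" "g \<in> Hom C a b"
  shows "f \<^bold>- g \<in> Hom C a b"
proof -
  interpret G: comm_group "Hom_group C a b"
    using comm_group_Hom_group Hom_Obj[OF assms(1)] by blast
  show ?thesis
    using assms carrier_Hom_group Hom_Obj[OF assms(1)] G.m_closed G.inv_closed
    by (auto simp: minus_arr_def Hom_Dom[OF assms(1)] Hom_Cod[OF assms(1)])
qed

lemma plus_zero:
  assumes "f \<in> Hom C a b"
  shows "f \<^bold>+ zero_arr C a b = f" "zero_arr C a b \<^bold>+ f = f"
proof -
  have ob: "a \<in> Obj C" "b \<in> Obj C"
    using Hom_Obj[OF assms] by auto
  interpret G: comm_group "Hom_group C a b"
    using comm_group_Hom_group ob by blast
  have f: "f \<in> carrier (Hom_group C a b)"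
    using assms carrier_Hom_group[OF ob] by simp
  show "f \<^bold>+ zero_arr C a b = f" "zero_arr C a b \<^bold>+ f = f"
    using f zero_in_Hom[OF ob]
    by (auto simp: plus_arr_def Hom_Dom[OF assms] Hom_Cod[OF assms] Hom_Dom Hom_Cod)
      (auto simp: zero_arr_def)
qed

text \<open>Reduces subtraction to addition, for which bilinearity of composition is assumed. The
  later rules for differences rest on this equivalence.\<close>

lemma minus_eq_iff:
  assumes "f \<in> Hom C a b" "g \<in> Hom C a b" "h \<in> Hom C a b"
  shows "f \<^bold>- g = h \<longleftrightarrow> f = h \<^bold>+ g"
proof -
  have ob: "a \<in> Obj C" "b \<in> Obj C"
    using Hom_Obj[OF assms(1)] by auto
  interpret G: comm_group "Hom_group C a b"
    using comm_group_Hom_group ob by blast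
  show ?thesis
    using assms(1,2,3)[folded carrier_Hom_group[OF ob]] G.inv_solve_right'[of h f g] G.inv_closed
    by (auto simp: minus_arr_def plus_arr_def Hom_Dom[OF assms(1)] Hom_Cod[OF assms(1)]
        Hom_Dom[OF assms(3)] Hom_Cod[OF assms(3)])
qed

lemma plus_commute:
  assumes "f \<in> Hom C a b" "g \<in> Hom C a b"
  shows "f \<^bold>+ g = g \<^bold>+ f"
proof -
  have ob: "a \<in> Obj C" "b \<in> Obj C"
    using Hom_Obj[OF assms(1)] by auto
  interpret G: comm_group "Hom_group C a b"
    using comm_group_Hom_group ob by blast
  show ?thesis
    using assms[folded carrier_Hom_group[OF ob]] G.m_comm
    by (auto simp: plus_arr_def Hom_Dom[OF assms(1)] Hom_Cod[OF assms(1)]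
        Hom_Dom[OF assms(2)] Hom_Cod[OF assms(2)])
qed

lemma minus_plus: "f \<in> Hom C a b \<Longrightarrow> g \<in> Hom C a b \<Longrightarrow> (f \<^bold>- g) \<^bold>+ g = f"
  using minus_eq_iff minus_in_Hom by metis

lemma minus_self: "f \<in> Hom C a b \<Longrightarrow> f \<^bold>- f = zero_arr C a b"
  using minus_eq_iff plus_zero(2) zero_in_Hom Hom_Obj by metis

lemma minus_zero: "f \<in> Hom C a b \<Longrightarrow> f \<^bold>- zero_arr C a b = f"
  using minus_eq_iff plus_zero(1) zero_in_Hom Hom_Obj by metis

lemma minus_swap:
  assumes "f \<in> Hom C a b" "g \<in> Hom C a b" "h \<in> Hom C a b" "f \<^bold>- g = h"
  shows "f \<^bold>- h = g"
  using minus_eq_iff plus_commute assms by metis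

lemma Comp_minus_left:
  assumes f: "f \<in> Hom C a b" and g: "g \<in> Hom C b c" "g' \<in> Hom C b c"
  shows "(g \<^bold>- g') \<cdot> f = (g \<cdot> f) \<^bold>- (g' \<cdot> f)"
  using Comp_plus_left[OF f minus_in_Hom[OF g] g(2)] minus_plus[OF g] minus_in_Hom[OF g]
    minus_eq_iff[OF Comp_in_Hom[OF f g(1)] Comp_in_Hom[OF f g(2)]] Comp_in_Hom[OF f] by metis

lemma Comp_minus_right:
  assumes f: "f \<in> Hom C a b" "f' \<in> Hom C a b" and g: "g \<in> Hom C b c"
  shows "g \<cdot> (f \<^bold>- f') = (g \<cdot> f) \<^bold>- (g \<cdot> f')"
  using Comp_plus_right[OF minus_in_Hom[OF f] f(2) g] minus_plus[OF f] minus_in_Hom[OF f]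
    minus_eq_iff[OF Comp_in_Hom[OF f(1) g] Comp_in_Hom[OF f(2) g]] Comp_in_Hom[OF _ g] by metis

lemma zero_Comp:
  assumes f: "f \<in> Hom C a b" and c: "c \<in> Obj C"
  shows "zero_arr C b c \<cdot> f = zero_arr C a c"
proof -
  have z: "zero_arr C b c \<in> Hom C b c"
    using zero_in_Hom Hom_Obj[OF f] c by blast
  \<comment> \<open>The zero arrow is \<open>z - z\<close>, so the composite is a difference of
    equal arrows.\<close>
  show ?thesis
    using Comp_minus_left[OF f z z] minus_self[OF z] minus_self[OF Comp_in_Hom[OF f z]] by simp
qed

lemma Comp_zero:
  assumes g: "g \<in> Hom C b c" and a: "a \<in> Obj C"
  shows "g \<cdot> zero_arr C a b = zero_arr C a c"
proof -
  have z: "zero_arr C a b \<in> Hom C a b"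
    using zero_in_Hom Hom_Obj[OF g] a by blast
  show ?thesis
    using Comp_minus_right[OF z z g] minus_self[OF z] minus_self[OF Comp_in_Hom[OF z g]] by simp
qed

lemma Zero_obj_in_Obj: "Zero_obj C \<in> Obj C"
  using Zero_obj_is_zero by (simp add: is_zero_object_def)

lemma from_Zero_obj_eq: "f \<in> Hom C (Zero_obj C) a \<Longrightarrow> g \<in> Hom C (Zero_obj C) a \<Longrightarrow> f = g"
  using Zero_obj_is_zero Hom_Obj unfolding is_zero_object_def by metis

lemma to_Zero_obj_eq: "f \<in> Hom C a (Zero_obj C) \<Longrightarrow> g \<in> Hom C a (Zero_obj C) \<Longrightarrow> f = g"
  using Zero_obj_is_zero Hom_Obj unfolding is_zero_object_def by metis

end

section \<open>Splitting off the kernel of a split epimorphism\<close>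

text \<open>The complement is the kernel \<open>k\<close> of \<open>\<sigma>\<close>. The idempotent
  complementary to \<open>s \<cdot> \<sigma>\<close> is killed by \<open>\<sigma>\<close>, so it
  factors through \<open>k\<close>, and the factor \<open>r\<close> is the second
  projection.\<close>

lemma (in wic_additive_category) split_biproduct:
  assumes \<sigma>: "\<sigma> \<in> Hom C e a" and s: "s \<in> Hom C a e" and \<sigma>s: "\<sigma> \<cdot> s = Id C a"
  shows "\<exists>b k r. is_biproduct C a b e s k \<sigma> r"
proof -
  have ob: "a \<in> Obj C" "e \<in> Obj C"
    using Hom_Obj[OF s] by auto
  have "split_epi C \<sigma>"
    using assms Hom_Arr[OF \<sigma>] unfolding split_epi_def Hom_Dom[OF \<sigma>] Hom_Cod[OF \<sigma>] by blast
  then obtain k where ker: "is_kernel C \<sigma> k"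
    using weakly_idempotent_complete by blast
  define b where "b = Dom C k"
  have k: "k \<in> Hom C b e"
    using ker Hom_Dom[OF \<sigma>] by (auto simp: is_kernel_def Hom_def b_def)
  have b: "b \<in> Obj C"
    using Hom_Obj[OF k] by blast
  have \<sigma>k: "\<sigma> \<cdot> k = zero_arr C b a"
    using ker Hom_Cod[OF \<sigma>] by (simp add: is_kernel_def b_def)
  have univ: "\<exists>!v. v \<in> Hom C t b \<and> k \<cdot> v = u"
    if "u \<in> Hom C t e" "\<sigma> \<cdot> u = zero_arr C t a" for t u
    using ker that Hom_Obj[OF that(1)]
    unfolding is_kernel_def Hom_Dom[OF \<sigma>] Hom_Cod[OF \<sigma>] b_def by blast
  \<comment> \<open>Uniqueness in the universal property makes \<open>k\<close> a monomorphism; the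
    equations for \<open>r\<close> are then checked after composing with \<open>k\<close>.\<close>
  have mono: "v = w" if v: "v \<in> Hom C t b" and w: "w \<in> Hom C t b" and eq: "k \<cdot> v = k \<cdot> w" for t v w
  proof -
    have "\<sigma> \<cdot> (k \<cdot> w) = zero_arr C t a"
      using Comp_assoc[OF w k \<sigma>] \<sigma>k zero_Comp[OF w ob(1)] by simp
    then show ?thesis
      using univ[OF Comp_in_Hom[OF w k]] v w eq by blast
  qed
  have I: "Id C e \<in> Hom C e e" "Id C b \<in> Hom C b b"
    using Id_in_Hom ob b by auto
  have s\<sigma>: "s \<cdot> \<sigma> \<in> Hom C e e"
    using Comp_in_Hom[OF \<sigma> s] .
  let ?e = "Id C e \<^bold>- (s \<cdot> \<sigma>)"
  have e: "?e \<in> Hom C e e"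
    using minus_in_Hom[OF I(1) s\<sigma>] .
  have "\<sigma> \<cdot> ?e = zero_arr C e a"
    using Comp_minus_right[OF I(1) s\<sigma> \<sigma>] Comp_Id[OF \<sigma>] Comp_assoc[OF \<sigma> s \<sigma>] \<sigma>s Id_Comp[OF \<sigma>]
      minus_self[OF \<sigma>] by simp
  then obtain r where r: "r \<in> Hom C e b" and kr: "k \<cdot> r = ?e"
    using univ[OF e] by blast
  have "?e \<cdot> k = k"
    using Comp_minus_left[OF k I(1) s\<sigma>] Id_Comp[OF k] Comp_assoc[OF k \<sigma> s] \<sigma>k
      Comp_zero[OF s b] minus_zero[OF k] by simp
  then have "k \<cdot> (r \<cdot> k) = k \<cdot> Id C b"
    using Comp_assoc[OF k r k] kr Comp_Id[OF k] by simp
  then have rk: "r \<cdot> k = Id C b"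
    using mono[OF Comp_in_Hom[OF k r] I(2)] by blast
  have "?e \<cdot> s = zero_arr C a e"
    using Comp_minus_left[OF s I(1) s\<sigma>] Id_Comp[OF s] Comp_assoc[OF s \<sigma> s] \<sigma>s
      Comp_Id[OF s] minus_self[OF s] by simp
  then have "k \<cdot> (r \<cdot> s) = k \<cdot> zero_arr C a b"
    using Comp_assoc[OF s r k] kr Comp_zero[OF k ob(1)] by simp
  then have rs: "r \<cdot> s = zero_arr C a b"
    using mono[OF Comp_in_Hom[OF s r] zero_in_Hom[OF ob(1) b]] by blast
  have "(s \<cdot> \<sigma>) \<^bold>+ (k \<cdot> r) = Id C e"
    using minus_plus[OF I(1) s\<sigma>] kr plus_commute[OF s\<sigma> e] by simp
  then show ?thesis
    unfolding is_biproduct_def using ob s k \<sigma> r \<sigma>s rk \<sigma>k rs by blast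
qed


section \<open>Model structures\<close>

context model_structure
begin

lemma Cofib_TFib_factorE:
  assumes "f \<in> Hom C a b"
  obtains e i p where "i \<in> Hom C a e" "p \<in> Hom C e b" "f = p \<cdot> i"
    "i \<in> Cofib" "p \<in> Fib" "p \<in> Weq"
proof -
  obtain i p where *: "i \<in> Cofib" "p \<in> Fib \<inter> Weq" "i \<in> Arr C" "p \<in> Arr C" "Cod C i = Dom C p"
      "f = p \<cdot> i"
    using Cofib_TFib_factor[OF Hom_Arr[OF assms]] unfolding factors_as_def by blast
  have i: "i \<in> Hom C (Dom C i) (Cod C i)" and p: "p \<in> Hom C (Cod C i) (Cod C p)"
    using * in_HomI by metis+
  have "Dom C i = a" "Cod C p = b"
    using Comp_in_Hom[OF i p] assms *(6) Hom_Dom Hom_Cod by metis+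
  then show thesis
    using that i p * by auto
qed

lemma TCofib_Fib_factorE:
  assumes "f \<in> Hom C a b"
  obtains e i p where "i \<in> Hom C a e" "p \<in> Hom C e b" "f = p \<cdot> i"
    "i \<in> Cofib" "i \<in> Weq" "p \<in> Fib"
proof -
  obtain i p where *: "i \<in> Cofib \<inter> Weq" "p \<in> Fib" "i \<in> Arr C" "p \<in> Arr C" "Cod C i = Dom C p"
      "f = p \<cdot> i"
    using TCofib_Fib_factor[OF Hom_Arr[OF assms]] unfolding factors_as_def by blast
  have i: "i \<in> Hom C (Dom C i) (Cod C i)" and p: "p \<in> Hom C (Cod C i) (Cod C p)"
    using * in_HomI by metis+
  have "Dom C i = a" "Cod C p = b"
    using Comp_in_Hom[OF i p] assms *(6) Hom_Dom Hom_Cod by metis+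
  then show thesis
    using that i p * by auto
qed

text \<open>Factor the identity with a trivial fibration \<open>p\<close> on the left. Both
  \<open>p\<close> and \<open>Id C a \<cdot> p = p\<close> are weak equivalences, so
  two-out-of-three cancels \<open>p\<close>.\<close>

lemma Id_in_Weq:
  assumes "a \<in> Obj C"
  shows "Id C a \<in> Weq"
proof -
  obtain e i p where "p \<in> Hom C e a" "p \<in> Weq"
    using Cofib_TFib_factorE[OF Id_in_Hom[OF assms]] by metis
  then show ?thesis
    using two_of_three_left[OF _ Id_in_Hom[OF assms]] Id_Comp by metis
qed

lemma Weq_section_iff:
  assumes i: "i \<in> Hom C a e" and p: "p \<in> Hom C e a" and pi: "p \<cdot> i = Id C a"
  shows "i \<in> Weq \<longleftrightarrow> p \<in> Weq"
  using two_of_three_left[OF i p] two_of_three_right[OF i p] Id_in_Weq Hom_Obj[OF i] pi by auto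

lemma Cofib_lift:
  assumes i: "i \<in> Hom C a b" "i \<in> Cofib" and p: "p \<in> Hom C x y" "p \<in> Fib" "p \<in> Weq"
    and "u \<in> Hom C a x" "v \<in> Hom C b y" "p \<cdot> u = v \<cdot> i"
  obtains l where "l \<in> Hom C b x" "l \<cdot> i = u" "p \<cdot> l = v"
  using Cofib_lifts[OF i(2), of p] assms unfolding lifts_against_def
  by (auto simp: Hom_Dom[OF i(1)] Hom_Cod[OF i(1)] Hom_Dom[OF p(1)] Hom_Cod[OF p(1)])

lemma TCofib_lift:
  assumes i: "i \<in> Hom C a b" "i \<in> Cofib" "i \<in> Weq" and p: "p \<in> Hom C x y" "p \<in> Fib"
    and "u \<in> Hom C a x" "v \<in> Hom C b y" "p \<cdot> u = v \<cdot> i"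
  obtains l where "l \<in> Hom C b x" "l \<cdot> i = u" "p \<cdot> l = v"
  using TCofib_lifts[OF _ p(2), of i] assms unfolding lifts_against_def
  by (auto simp: Hom_Dom[OF i(1)] Hom_Cod[OF i(1)] Hom_Dom[OF p(1)] Hom_Cod[OF p(1)])

text \<open>Lifts along \<open>f\<close> and then along \<open>g\<close> give a lift along the
  composite. Doing this against the trivial fibration of a factorization of
  \<open>g \<cdot> f\<close> makes the composite a retract of a cofibration.\<close>

lemma Cofib_Comp:
  assumes f: "f \<in> Hom C a b" "f \<in> Cofib" and g: "g \<in> Hom C b c" "g \<in> Cofib"
  shows "g \<cdot> f \<in> Cofib"
proof -
  have gf: "g \<cdot> f \<in> Hom C a c"
    using Comp_in_Hom[OF f(1) g(1)] .
  obtain e i p where ip: "i \<in> Hom C a e" "p \<in> Hom C e c" "g \<cdot> f = p \<cdot> i"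
    "i \<in> Cofib" "p \<in> Fib" "p \<in> Weq"
    using Cofib_TFib_factorE[OF gf] by metis
  have "lifts_against C (g \<cdot> f) p"
    unfolding lifts_against_def Hom_Dom[OF gf] Hom_Cod[OF gf] Hom_Dom[OF ip(2)] Hom_Cod[OF ip(2)]
  proof (intro ballI impI)
    fix u v assume u: "u \<in> Hom C a e" and v: "v \<in> Hom C c c" and eq: "p \<cdot> u = v \<cdot> (g \<cdot> f)"
    \<comment> \<open>The lift \<open>m\<close> along \<open>f\<close> has lower edge
      \<open>v \<cdot> g\<close>, so it is the upper edge of a square for \<open>g\<close>.\<close>
    obtain m where m: "m \<in> Hom C b e" "m \<cdot> f = u" "p \<cdot> m = v \<cdot> g"
      using Cofib_lift[OF f ip(2,5,6) u Comp_in_Hom[OF g(1) v]] eq Comp_assoc[OF f(1) g(1) v]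
      by metis
    obtain l where l: "l \<in> Hom C c e" "l \<cdot> g = m" "p \<cdot> l = v"
      using Cofib_lift[OF g ip(2,5,6) m(1) v m(3)] by metis
    show "\<exists>l\<in>Hom C c e. l \<cdot> (g \<cdot> f) = u \<and> p \<cdot> l = v"
      using l m(2) Comp_assoc[OF f(1) g(1) l(1)] by metis
  qed
  then show ?thesis
    using retract_of_left_factor[OF ip(1-3)] Cofib_retract ip(4) by blast
qed

end

section \<open>Trivial objects and biproducts in an additive model structure\<close>

locale wic_additive_model = wic_additive_category C + model_structure C Cofib Fib Weq
  for C :: "('o, 'm, 'x) additive_data_scheme" (structure) and Cofib Fib Weq :: "'m set"
begin

text \<open>The inclusion \<open>i\<close> is the pushout of the trivial cofibration from the zero
  object to \<open>w\<close>, so it inherits lifting against fibrations. The lift is built by hand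
  from the biproduct, and the retract argument makes \<open>i\<close> a retract of the weak
  equivalence \<open>c\<close>.\<close>

lemma biproduct_inclusion_in_Weq:
  assumes bip: "is_biproduct C a w e i j p q"
    and w: "w \<in> cofibrant_objects C Cofib" "w \<in> trivial_objects C Weq"
  shows "i \<in> Weq"
proof -
  have ob: "w \<in> Obj C" and i: "i \<in> Hom C a e" and j: "j \<in> Hom C w e" and p: "p \<in> Hom C e a"
    and q: "q \<in> Hom C e w" and pi: "p \<cdot> i = Id C a" and qi: "q \<cdot> i = zero_arr C a w"
    and sum: "(i \<cdot> p) \<^bold>+ (j \<cdot> q) = Id C e"
    using bip w by (auto simp: is_biproduct_def cofibrant_objects_def)
  have a: "a \<in> Obj C"
    using Hom_Obj[OF i] by blast
  let ?z = "zero_arr C (Zero_obj C) w"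
  have z: "?z \<in> Hom C (Zero_obj C) w" "?z \<in> Cofib" "?z \<in> Weq"
    using w zero_in_Hom Zero_obj_in_Obj by (auto simp: cofibrant_objects_def trivial_objects_def)
  obtain e' c r where cr: "c \<in> Hom C a e'" "r \<in> Hom C e' e" "i = r \<cdot> c"
    "c \<in> Cofib" "c \<in> Weq" "r \<in> Fib"
    using TCofib_Fib_factorE[OF i] by metis
  have "lifts_against C i r"
    unfolding lifts_against_def Hom_Dom[OF i] Hom_Cod[OF i] Hom_Dom[OF cr(2)] Hom_Cod[OF cr(2)]
  proof (intro ballI impI)
    fix u v assume u: "u \<in> Hom C a e'" and v: "v \<in> Hom C e e" and eq: "r \<cdot> u = v \<cdot> i"
    have e': "e' \<in> Obj C"
      using Hom_Obj[OF u] by blast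
    have vj: "v \<cdot> j \<in> Hom C w e"
      using Comp_in_Hom[OF j v] .
    have z': "zero_arr C (Zero_obj C) e' \<in> Hom C (Zero_obj C) e'"
      using zero_in_Hom[OF Zero_obj_in_Obj e'] .
    \<comment> \<open>Lift the \<open>w\<close>-component of \<open>v\<close> through
      \<open>r\<close>; the square commutes because it starts at the zero object.\<close>
    obtain l where l: "l \<in> Hom C w e'" "r \<cdot> l = v \<cdot> j"
      using TCofib_lift[OF z cr(2,6) z' vj from_Zero_obj_eq[OF Comp_in_Hom[OF z' cr(2)]
            Comp_in_Hom[OF z(1) vj]]] by metis
    have up: "u \<cdot> p \<in> Hom C e e'" and lq: "l \<cdot> q \<in> Hom C e e'"
      and ip: "i \<cdot> p \<in> Hom C e e" and jq: "j \<cdot> q \<in> Hom C e e"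
      using Comp_in_Hom u p l q i j by blast+
    \<comment> \<open>The arrow out of the biproduct with components \<open>u\<close> on
      \<open>a\<close> and \<open>l\<close> on \<open>w\<close>.\<close>
    let ?m = "(u \<cdot> p) \<^bold>+ (l \<cdot> q)"
    have "?m \<cdot> i = u"
      using Comp_plus_left[OF i up lq] Comp_assoc[OF i p u] Comp_assoc[OF i q l(1)] pi qi
        Comp_Id[OF u] Comp_zero[OF l(1) a] plus_zero(1)[OF u] by simp
    moreover have "r \<cdot> ?m = v"
      using Comp_plus_right[OF up lq cr(2)] Comp_assoc[OF p u cr(2)] Comp_assoc[OF q l(1) cr(2)]
        eq l(2) Comp_assoc[OF p i v] Comp_assoc[OF q j v] Comp_plus_right[OF ip jq v] sum
        Comp_Id[OF v] by simp
    ultimately show "\<exists>l\<in>Hom C e e'. l \<cdot> i = u \<and> r \<cdot> l = v"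
      using plus_in_Hom[OF up lq] by blast
  qed
  then show ?thesis
    using retract_of_left_factor[OF cr(1-3)] Weq_retract cr(5) by blast
qed

text \<open>The arrow from zero to \<open>k\<close> is a retract of \<open>i\<close>: the domains
  retract by passing through \<open>a\<close>, the codomains by \<open>j\<close> and
  \<open>q\<close>. The square from \<open>i\<close> back commutes because
  \<open>q \<cdot> i\<close> is zero.\<close>

lemma trivial_summand:
  assumes bip: "is_biproduct C a k e i j p q" and iw: "i \<in> Weq"
  shows "k \<in> trivial_objects C Weq"
proof -
  have i: "i \<in> Hom C a e" and j: "j \<in> Hom C k e" and p: "p \<in> Hom C e a"
    and q: "q \<in> Hom C e k" and qj: "q \<cdot> j = Id C k" and qi: "q \<cdot> i = zero_arr C a k"
    using bip by (auto simp: is_biproduct_def)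
  have a: "a \<in> Obj C" and k: "k \<in> Obj C"
    using Hom_Obj[OF i] Hom_Obj[OF j] by auto
  let ?o = "Zero_obj C"
  note o = Zero_obj_in_Obj
  have z: "zero_arr C ?o k \<in> Hom C ?o k" "zero_arr C ?o a \<in> Hom C ?o a"
    "zero_arr C a ?o \<in> Hom C a ?o"
    using zero_in_Hom o a k by auto
  have "retract_of C (zero_arr C ?o k) i"
    unfolding retract_of_def Hom_Dom[OF i] Hom_Cod[OF i] Hom_Dom[OF z(1)] Hom_Cod[OF z(1)]
  proof (intro conjI bexI)
    show "zero_arr C a ?o \<cdot> zero_arr C ?o a = Id C ?o"
      using from_Zero_obj_eq[OF Comp_in_Hom[OF z(2,3)] Id_in_Hom[OF o]] .
    show "i \<cdot> zero_arr C ?o a = j \<cdot> zero_arr C ?o k"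
      using from_Zero_obj_eq[OF Comp_in_Hom[OF z(2) i] Comp_in_Hom[OF z(1) j]] .
    show "zero_arr C ?o k \<cdot> zero_arr C a ?o = q \<cdot> i"
      using qi zero_Comp[OF z(3) k] by simp
  qed (use z qj j q Hom_Arr[OF i] Hom_Arr[OF z(1)] in auto)
  then show ?thesis
    using Weq_retract iw k by (simp add: trivial_objects_def)
qed

text \<open>Replace \<open>k\<close> first by a cofibrant \<open>k'\<close> with a trivial fibration
  to \<open>k\<close>, then \<open>k'\<close> by a fibrant \<open>w\<close> receiving a trivial
  cofibration from \<open>k'\<close>. The second replacement preserves cofibrancy because
  cofibrations compose, and triviality because weak equivalences do.\<close>

lemma factor_through_cofibrant_fibrant_trivial:
  assumes a: "a \<in> cofibrant_objects C Cofib" and b: "b \<in> fibrant_objects C Fib"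
    and k: "k \<in> trivial_objects C Weq"
    and u: "u \<in> Hom C a k" and v: "v \<in> Hom C k b"
  shows "\<exists>w \<in> cofibrant_objects C Cofib \<inter> fibrant_objects C Fib \<inter> trivial_objects C Weq.
    factors_through C (v \<cdot> u) w"
proof -
  have ob: "a \<in> Obj C" "b \<in> Obj C" "k \<in> Obj C"
    using Hom_Obj[OF u] Hom_Obj[OF v] by auto
  let ?o = "Zero_obj C"
  note o = Zero_obj_in_Obj
  have z: "zero_arr C x y \<in> Hom C x y" if "x \<in> Obj C" "y \<in> Obj C" for x y
    using zero_in_Hom that .
  have to_k: "zero_arr C ?o k \<in> Weq" and to_a: "zero_arr C ?o a \<in> Cofib"
    and from_b: "zero_arr C b ?o \<in> Fib"
    using a b k by (auto simp: cofibrant_objects_def fibrant_objects_def trivial_objects_def)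
  obtain k' i p where k': "i \<in> Hom C ?o k'" "p \<in> Hom C k' k" "zero_arr C ?o k = p \<cdot> i"
    "i \<in> Cofib" "p \<in> Fib" "p \<in> Weq"
    using Cofib_TFib_factorE[OF z[OF o ob(3)]] by metis
  have iW: "i \<in> Weq"
    using two_of_three_right[OF k'(1,2,6)] k'(3) to_k by simp
  have ok': "k' \<in> Obj C"
    using Hom_Obj[OF k'(2)] by blast
  \<comment> \<open>Cofibrancy of \<open>a\<close> lifts \<open>u\<close> through the trivial
    fibration \<open>p\<close>.\<close>
  obtain u' where u': "u' \<in> Hom C a k'" "p \<cdot> u' = u"
    using Cofib_lift[OF z[OF o ob(1)] to_a k'(2,5,6,1) u
        from_Zero_obj_eq[OF Comp_in_Hom[OF k'(1,2)] Comp_in_Hom[OF z[OF o ob(1)] u]]] by metis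
  obtain w c r where w: "c \<in> Hom C k' w" "r \<in> Hom C w ?o" "zero_arr C k' ?o = r \<cdot> c"
    "c \<in> Cofib" "c \<in> Weq" "r \<in> Fib"
    using TCofib_Fib_factorE[OF z[OF ok' o]] by metis
  have ow: "w \<in> Obj C"
    using Hom_Obj[OF w(1)] by blast
  have vp: "v \<cdot> p \<in> Hom C k' b"
    using Comp_in_Hom[OF k'(2) v] .
  \<comment> \<open>Fibrancy of \<open>b\<close> extends \<open>v \<cdot> p\<close> along the
    trivial cofibration \<open>c\<close>.\<close>
  obtain v' where v': "v' \<in> Hom C w b" "v' \<cdot> c = v \<cdot> p"
    using TCofib_lift[OF w(1,4,5) z[OF ob(2) o] from_b vp w(2)
        to_Zero_obj_eq[OF Comp_in_Hom[OF vp z[OF ob(2) o]] Comp_in_Hom[OF w(1,2)]]] by metis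
  have "c \<cdot> i = zero_arr C ?o w" "r = zero_arr C w ?o"
    using from_Zero_obj_eq[OF Comp_in_Hom[OF k'(1) w(1)] z[OF o ow]]
      to_Zero_obj_eq[OF w(2) z[OF ow o]] by auto
  then have "w \<in> cofibrant_objects C Cofib \<inter> fibrant_objects C Fib \<inter> trivial_objects C Weq"
    using ow w(6) Cofib_Comp[OF k'(1,4) w(1,4)] two_of_three_comp[OF k'(1) w(1) iW w(5)]
    by (simp add: cofibrant_objects_def fibrant_objects_def trivial_objects_def)
  moreover have "v' \<cdot> (c \<cdot> u') = v \<cdot> u"
    using Comp_assoc[OF u'(1) w(1) v'(1)] Comp_assoc[OF u'(1) k'(2) v] u'(2) v'(2) by simp
  then have "factors_through C (v \<cdot> u) w"
    unfolding factors_through_def Hom_Dom[OF Comp_in_Hom[OF u v]] Hom_Cod[OF Comp_in_Hom[OF u v]]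
    using Comp_in_Hom[OF u'(1) w(1)] v'(1) by metis
  ultimately show ?thesis by blast
qed

section \<open>From homotopies to factorizations\<close>

lemma left_homotopic_imp_factors:
  assumes a: "a \<in> cofibrant_objects C Cofib" and b: "b \<in> fibrant_objects C Fib"
    and hom: "left_homotopic C Weq a b f g"
  shows "\<exists>w \<in> cofibrant_objects C Cofib \<inter> fibrant_objects C Fib \<inter> trivial_objects C Weq.
    factors_through C (f \<^bold>- g) w"
proof -
  obtain e \<sigma> d0 d1 h where \<sigma>: "\<sigma> \<in> Hom C e a" "\<sigma> \<in> Weq" and d0: "d0 \<in> Hom C a e"
    and d1: "d1 \<in> Hom C a e" and h: "h \<in> Hom C e b" and eq: "\<sigma> \<cdot> d0 = Id C a"
    "\<sigma> \<cdot> d1 = Id C a" "h \<cdot> d0 = f" "h \<cdot> d1 = g"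
    using hom unfolding left_homotopic_def by blast
  obtain k j q where bip: "is_biproduct C a k e d0 j \<sigma> q"
    using split_biproduct[OF \<sigma>(1) d0 eq(1)] by blast
  have j: "j \<in> Hom C k e" and q: "q \<in> Hom C e k"
    and sum: "(d0 \<cdot> \<sigma>) \<^bold>+ (j \<cdot> q) = Id C e"
    using bip by (auto simp: is_biproduct_def)
  \<comment> \<open>As a section of the weak equivalence \<open>\<sigma>\<close>, \<open>d0\<close>
    is itself one, so its complement is trivial.\<close>
  have k: "k \<in> trivial_objects C Weq"
    using trivial_summand[OF bip] Weq_section_iff[OF d0 \<sigma>(1) eq(1)] \<sigma>(2) by blast
  have ob: "a \<in> Obj C"
    using Hom_Obj[OF d0] by blast
  let ?d = "d0 \<^bold>- d1"
  have d: "?d \<in> Hom C a e"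
    using minus_in_Hom[OF d0 d1] .
  have "\<sigma> \<cdot> ?d = zero_arr C a a"
    using Comp_minus_right[OF d0 d1 \<sigma>(1)] eq minus_self[OF Id_in_Hom[OF ob]] by simp
  \<comment> \<open>Expand \<open>Id C e\<close> as the biproduct sum: the part through
    \<open>\<sigma>\<close> vanishes on \<open>?d\<close>, leaving the part through
    \<open>k\<close>.\<close>
  then have "?d = j \<cdot> (q \<cdot> ?d)"
    using Comp_plus_left[OF d Comp_in_Hom[OF \<sigma>(1) d0] Comp_in_Hom[OF q j]] sum Id_Comp[OF d]
      Comp_assoc[OF d \<sigma>(1) d0] Comp_assoc[OF d q j] Comp_zero[OF d0 ob]
      plus_zero(2)[OF Comp_in_Hom[OF Comp_in_Hom[OF d q] j]] by simp
  then have "f \<^bold>- g = (h \<cdot> j) \<cdot> (q \<cdot> ?d)"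
    using Comp_minus_right[OF d0 d1 h] eq Comp_assoc[OF Comp_in_Hom[OF d q] j h] by simp
  then show ?thesis
    using factor_through_cofibrant_fibrant_trivial[OF a b k Comp_in_Hom[OF d q] Comp_in_Hom[OF j h]]
    by simp
qed

text \<open>Dual to the left case: \<open>e\<close> splits with inclusion \<open>\<sigma>\<close>
  and projection \<open>d0\<close>, and the difference of the two retractions of
  \<open>\<sigma>\<close> factors through the projection \<open>q\<close> to the complement.\<close>

lemma right_homotopic_imp_factors:
  assumes a: "a \<in> cofibrant_objects C Cofib" and b: "b \<in> fibrant_objects C Fib"
    and hom: "right_homotopic C Weq a b f g"
  shows "\<exists>w \<in> cofibrant_objects C Cofib \<inter> fibrant_objects C Fib \<inter> trivial_objects C Weq.
    factors_through C (f \<^bold>- g) w"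
proof -
  obtain e \<sigma> d0 d1 h where \<sigma>: "\<sigma> \<in> Hom C b e" "\<sigma> \<in> Weq" and d0: "d0 \<in> Hom C e b"
    and d1: "d1 \<in> Hom C e b" and h: "h \<in> Hom C a e" and eq: "d0 \<cdot> \<sigma> = Id C b"
    "d1 \<cdot> \<sigma> = Id C b" "d0 \<cdot> h = f" "d1 \<cdot> h = g"
    using hom unfolding right_homotopic_def by blast
  obtain k j q where bip: "is_biproduct C b k e \<sigma> j d0 q"
    using split_biproduct[OF d0 \<sigma>(1) eq(1)] by blast
  have j: "j \<in> Hom C k e" and q: "q \<in> Hom C e k"
    and sum: "(\<sigma> \<cdot> d0) \<^bold>+ (j \<cdot> q) = Id C e"
    using bip by (auto simp: is_biproduct_def)
  have k: "k \<in> trivial_objects C Weq"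
    using trivial_summand[OF bip \<sigma>(2)] .
  have ob: "b \<in> Obj C"
    using Hom_Obj[OF d0] by blast
  let ?d = "d0 \<^bold>- d1"
  have d: "?d \<in> Hom C e b"
    using minus_in_Hom[OF d0 d1] .
  have "?d \<cdot> \<sigma> = zero_arr C b b"
    using Comp_minus_left[OF \<sigma>(1) d0 d1] eq minus_self[OF Id_in_Hom[OF ob]] by simp
  then have "?d = (?d \<cdot> j) \<cdot> q"
    using Comp_plus_right[OF Comp_in_Hom[OF d0 \<sigma>(1)] Comp_in_Hom[OF q j] d] sum Comp_Id[OF d]
      Comp_assoc[OF d0 \<sigma>(1) d] Comp_assoc[OF q j d] zero_Comp[OF d0 ob]
      plus_zero(2)[OF Comp_in_Hom[OF Comp_in_Hom[OF q j] d]] by simp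
  then have "f \<^bold>- g = (?d \<cdot> j) \<cdot> (q \<cdot> h)"
    using Comp_minus_left[OF h d0 d1] eq Comp_assoc[OF h q Comp_in_Hom[OF j d]] by simp
  then show ?thesis
    using factor_through_cofibrant_fibrant_trivial[OF a b k Comp_in_Hom[OF h q] Comp_in_Hom[OF j d]]
    by simp
qed

section \<open>From factorizations to homotopies\<close>

lemma factors_imp_left_homotopic:
  assumes f: "f \<in> Hom C a b" and g: "g \<in> Hom C a b"
    and w: "w \<in> cofibrant_objects C Cofib" "w \<in> trivial_objects C Weq"
    and fac: "factors_through C (f \<^bold>- g) w"
  shows "left_homotopic C Weq a b f g"
proof -
  have fg: "f \<^bold>- g \<in> Hom C a b"
    using minus_in_Hom[OF f g] .
  obtain u v where u: "u \<in> Hom C a w" and v: "v \<in> Hom C w b" and uv: "f \<^bold>- g = v \<cdot> u"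
    using fac unfolding factors_through_def Hom_Dom[OF fg] Hom_Cod[OF fg] by blast
  have ob: "a \<in> Obj C" "b \<in> Obj C" "w \<in> Obj C"
    using Hom_Obj[OF u] Hom_Obj[OF v] by auto
  obtain e i j p q where bip: "is_biproduct C a w e i j p q"
    using biproducts[OF ob(1,3)] by blast
  have e: "e \<in> Obj C" and i: "i \<in> Hom C a e" and j: "j \<in> Hom C w e" and p: "p \<in> Hom C e a"
    and q: "q \<in> Hom C e w" and pi: "p \<cdot> i = Id C a" and qi: "q \<cdot> i = zero_arr C a w"
    and pj: "p \<cdot> j = zero_arr C w a" and qj: "q \<cdot> j = Id C w"
    using bip by (auto simp: is_biproduct_def)
  have pW: "p \<in> Hom C e a \<inter> Weq"
    using biproduct_inclusion_in_Weq[OF bip w] Weq_section_iff[OF i p pi] p by blast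
  have ju: "j \<cdot> u \<in> Hom C a e" and fp: "f \<cdot> p \<in> Hom C e b" and vq: "v \<cdot> q \<in> Hom C e b"
    using Comp_in_Hom u j p f q v by blast+
  \<comment> \<open>\<open>?d\<close> has components \<open>(Id, u)\<close> and \<open>?h\<close>
    has components \<open>(f, -v)\<close>. The sign makes the second end
    \<open>f - v \<cdot> u = f - (f - g) = g\<close>, while \<open>i\<close> gives the first end
    \<open>f\<close>.\<close>
  let ?d = "i \<^bold>+ (j \<cdot> u)" and ?h = "(f \<cdot> p) \<^bold>- (v \<cdot> q)"
  have d: "?d \<in> Hom C a e" and h: "?h \<in> Hom C e b"
    using plus_in_Hom[OF i ju] minus_in_Hom[OF fp vq] by auto
  have pd: "p \<cdot> ?d = Id C a"
    using Comp_plus_right[OF i ju p] Comp_assoc[OF u j p] pi pj zero_Comp[OF u ob(1)]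
      plus_zero(1)[OF Id_in_Hom[OF ob(1)]] by simp
  have qd: "q \<cdot> ?d = u"
    using Comp_plus_right[OF i ju q] Comp_assoc[OF u j q] qi qj Id_Comp[OF u] plus_zero(2)[OF u]
    by simp
  have hi: "?h \<cdot> i = f"
    using Comp_minus_left[OF i fp vq] Comp_assoc[OF i p f] Comp_assoc[OF i q v] pi qi Comp_Id[OF f]
      Comp_zero[OF v ob(1)] minus_zero[OF f] by simp
  have hd: "?h \<cdot> ?d = g"
    using Comp_minus_left[OF d fp vq] Comp_assoc[OF d p f] Comp_assoc[OF d q v] pd qd Comp_Id[OF f]
      minus_swap[OF f g Comp_in_Hom[OF u v] uv] by simp
  show ?thesis
    unfolding left_homotopic_def using f g e pW i d h pi pd hi hd by blast
qed

lemma factors_imp_right_homotopic: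
  assumes f: "f \<in> Hom C a b" and g: "g \<in> Hom C a b"
    and w: "w \<in> cofibrant_objects C Cofib" "w \<in> trivial_objects C Weq"
    and fac: "factors_through C (f \<^bold>- g) w"
  shows "right_homotopic C Weq a b f g"
proof -
  have fg: "f \<^bold>- g \<in> Hom C a b"
    using minus_in_Hom[OF f g] .
  obtain u v where u: "u \<in> Hom C a w" and v: "v \<in> Hom C w b" and uv: "f \<^bold>- g = v \<cdot> u"
    using fac unfolding factors_through_def Hom_Dom[OF fg] Hom_Cod[OF fg] by blast
  have ob: "a \<in> Obj C" "b \<in> Obj C" "w \<in> Obj C"
    using Hom_Obj[OF u] Hom_Obj[OF v] by auto
  obtain e i j p q where bip: "is_biproduct C b w e i j p q"
    using biproducts[OF ob(2,3)] by blast
  have e: "e \<in> Obj C" and i: "i \<in> Hom C b e" and j: "j \<in> Hom C w e" and p: "p \<in> Hom C e b"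
    and q: "q \<in> Hom C e w" and pi: "p \<cdot> i = Id C b" and qi: "q \<cdot> i = zero_arr C b w"
    and pj: "p \<cdot> j = zero_arr C w b" and qj: "q \<cdot> j = Id C w"
    using bip by (auto simp: is_biproduct_def)
  have iW: "i \<in> Hom C b e \<inter> Weq"
    using biproduct_inclusion_in_Weq[OF bip w] i by blast
  have i_f: "i \<cdot> f \<in> Hom C a e" and ju: "j \<cdot> u \<in> Hom C a e" and vq: "v \<cdot> q \<in> Hom C e b"
    using Comp_in_Hom u j i f q v by blast+
  \<comment> \<open>Here the sign sits in the second projection of the path object:
    \<open>?d\<close> has components \<open>(Id, -v)\<close> and \<open>?h\<close> has components
    \<open>(f, u)\<close>, so \<open>?d \<cdot> ?h = f - v \<cdot> u = g\<close>, while
    \<open>p\<close> recovers \<open>f\<close>.\<close>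
  let ?d = "p \<^bold>- (v \<cdot> q)" and ?h = "(i \<cdot> f) \<^bold>+ (j \<cdot> u)"
  have d: "?d \<in> Hom C e b" and h: "?h \<in> Hom C a e"
    using plus_in_Hom[OF i_f ju] minus_in_Hom[OF p vq] by auto
  have di: "?d \<cdot> i = Id C b"
    using Comp_minus_left[OF i p vq] Comp_assoc[OF i q v] pi qi Comp_zero[OF v ob(2)]
      minus_zero[OF Id_in_Hom[OF ob(2)]] by simp
  have ph: "p \<cdot> ?h = f"
    using Comp_plus_right[OF i_f ju p] Comp_assoc[OF f i p] Comp_assoc[OF u j p] pi pj Id_Comp[OF f]
      zero_Comp[OF u ob(2)] plus_zero(1)[OF f] by simp
  have qh: "q \<cdot> ?h = u"
    using Comp_plus_right[OF i_f ju q] Comp_assoc[OF f i q] Comp_assoc[OF u j q] qi qj Id_Comp[OF u]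
      zero_Comp[OF f ob(3)] plus_zero(2)[OF u] by simp
  have dh: "?d \<cdot> ?h = g"
    using Comp_minus_left[OF h p vq] Comp_assoc[OF h q v] ph qh
      minus_swap[OF f g Comp_in_Hom[OF u v] uv] by simp
  show ?thesis
    unfolding right_homotopic_def using f g e iW p d h pi di ph dh by blast
qed

end

theorem theoremC:
  fixes \<A> :: "('o, 'm) additive_data" (structure)
    and Cofib Fib Weq :: "'m set"
    and A B :: 'o
    and f g :: 'm
  assumes "wic_additive_category \<A>"
    and "model_structure \<A> Cofib Fib Weq"
    and "A \<in> cofibrant_objects \<A> Cofib \<inter> fibrant_objects \<A> Fib"
    and "B \<in> cofibrant_objects \<A> Cofib \<inter> fibrant_objects \<A> Fib"
    and "f \<in> Hom \<A> A B" and "g \<in> Hom \<A> A B"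
  shows "(left_homotopic \<A> Weq A B f g \<longleftrightarrow>
           (\<exists>W \<in> cofibrant_objects \<A> Cofib \<inter> fibrant_objects \<A> Fib \<inter> trivial_objects \<A> Weq.
              factors_through \<A> (f \<^bold>- g) W)) \<and>
         (right_homotopic \<A> Weq A B f g \<longleftrightarrow>
           (\<exists>W \<in> cofibrant_objects \<A> Cofib \<inter> fibrant_objects \<A> Fib \<inter> trivial_objects \<A> Weq.
              factors_through \<A> (f \<^bold>- g) W))"
proof -
  interpret wic_additive_model \<A> Cofib Fib Weq
    using assms(1,2) by (simp add: wic_additive_model_def)
  show ?thesis
    using left_homotopic_imp_factors[of A B f g] right_homotopic_imp_factors[of A B f g]
      factors_imp_left_homotopic[OF assms(5,6)] factors_imp_right_homotopic[OF assms(5,6)]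
      assms(3,4) by blast
qed

end
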